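(* Let $N\in\mathbb{N}$, $\tau>0$, and let $H:\mathbb{R}^N\to[0,\infty)$ and $F:\mathbb{R}^N\to[0,\infty)$ be given functions. Let $(v^k)_{k\ge 0}\subset\mathbb{R}^N$ be any sequence and set $P(v^k):=-\tau^{-1}\big(H(v^k)-H(v^{k-1})\big)$ for $k\ge 1$. Assume that: (A1) there exist $C_m,C_M>0$ such that $C_mF(v^k)\le P(v^k)\le C_MF(v^k)$ for all $k\in\mathbb{N}$; (A2) there exists $\kappa>0$ such that $F(v^k)-F(v^{k-1})\le-\tau\kappa F(v^k)$ for all $k\in\mathbb{N}$; (A3) $\lim_{k\to\infty}H(v^k)=0$. Then $$H(v^k)\le e^{-\eta\lambda k\tau}H(v^0),\quad k\in\mathbb{N},$$ where $\lambda=(C_m/C_M)\kappa$ and $\eta=\log(1+\tau\lambda)/(\tau\lambda)\in(0,1)$.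
   Context: Here $\mathbb{N}=\{1,2,3,\ldots\}$. $H$ is called the entropy, $F$ the Fisher information, and $P$ the entropy production; no relation between $H$, $F$ and the sequence is assumed other than (A1)–(A3). *)

theory Defs
  imports "HOL-Analysis.Analysis"
begin

text \<open>The entropy production \<open>P(v\<^sup>k)\<close> depends on the step \<open>k\<close> of the sequence and not only on
  the point \<open>v\<^sup>k\<close>. It is meaningful only for \<open>k \<ge> 1\<close>: natural-number subtraction
  makes the value at \<open>k = 0\<close> a dummy \<open>0\<close>.\<close>

definition entropy_production :: "real \<Rightarrow> ('a \<Rightarrow> real) \<Rightarrow> (nat \<Rightarrow> 'a) \<Rightarrow> nat \<Rightarrow> real" where
  "entropy_production \<tau> H v k = - inverse \<tau> * (H (v k) - H (v (k - 1)))"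

end

theory Submission
  imports Defs
begin

text \<open>By (A1) and (A2) the entropy dissipated in one step is at most \<open>C\<^sub>M / \<kappa>\<close> times the
  Fisher information lost in that step. Summing over all later steps, where (A3) makes the entropy
  telescope to \<open>H(v\<^sup>k)\<close>, gives \<open>H(v\<^sup>k) \<le> (C\<^sub>M / \<kappa>) F(v\<^sup>k)\<close>, and the lower bound in (A1) turns
  this into \<open>\<lambda> H(v\<^sup>k) \<le> P(v\<^sup>k)\<close>. Hence each step contracts the entropy by the factor
  \<open>1 / (1 + \<tau> \<lambda>) = exp (- \<eta> \<lambda> \<tau>)\<close>.\<close>

text \<open>The difference \<open>h - g\<close> is nondecreasing, and \<open>g n \<ge> 0\<close>
  keeps it below \<open>h n\<close>. So \<open>h k - g k\<close> is at most every later
  \<open>h n\<close>, and these tend to 0.\<close>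

lemma le_if_decrement_le:
  fixes h g :: "nat \<Rightarrow> real"
  assumes dec: "\<And>k. h k - h (Suc k) \<le> g k - g (Suc k)"
    and g_nonneg: "\<And>k. 0 \<le> g k"
    and h_lim: "h \<longlonglongrightarrow> 0"
  shows "h k \<le> g k"
proof -
  have "incseq (\<lambda>n. h n - g n)"
  proof (rule incseq_SucI)
    show "h n - g n \<le> h (Suc n) - g (Suc n)" for n
      using dec[of n] by simp
  qed
  then have "h k - g k \<le> h n" if "n \<ge> k" for n
    using incseqD[of "\<lambda>n. h n - g n" k n] that g_nonneg[of n] by simp
  then have "h k - g k \<le> 0"
    by (intro LIMSEQ_le_const[OF h_lim]) blast
  then show ?thesis by simp
qed

lemma geometric_decay:
  fixes h :: "nat \<Rightarrow> real"
  assumes "q > 0" and step: "\<And>k. q * h (Suc k) \<le> h k"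
  shows "q ^ k * h k \<le> h 0"
proof (induction k)
  case (Suc k)
  have "q ^ Suc k * h (Suc k) = q ^ k * (q * h (Suc k))" by simp
  also have "\<dots> \<le> q ^ k * h k"
    using step[of k] \<open>q > 0\<close> by (intro mult_left_mono) simp_all
  also have "\<dots> \<le> h 0" by (rule Suc.IH)
  finally show ?case .
qed simp

theorem proposition5:
  fixes H F :: "real ^ 'n \<Rightarrow> real"
    and v :: "nat \<Rightarrow> real ^ 'n"
    and \<tau> C\<^sub>m C\<^sub>M \<kappa> lam \<eta> :: real
  assumes "\<tau> > 0"
    and H_nonneg: "\<And>x. H x \<ge> 0"
    and F_nonneg: "\<And>x. F x \<ge> 0"
    and "C\<^sub>m > 0" and "C\<^sub>M > 0"
    and A1: "\<And>k. k \<ge> 1 \<Longrightarrow> C\<^sub>m * F (v k) \<le> entropy_production \<tau> H v k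
                         \<and> entropy_production \<tau> H v k \<le> C\<^sub>M * F (v k)"
    and "\<kappa> > 0"
    and A2: "\<And>k. k \<ge> 1 \<Longrightarrow> F (v k) - F (v (k - 1)) \<le> - \<tau> * \<kappa> * F (v k)"
    and A3: "(\<lambda>k. H (v k)) \<longlonglongrightarrow> 0"
    and lam: "lam = (C\<^sub>m / C\<^sub>M) * \<kappa>"
    and eta: "\<eta> = ln (1 + \<tau> * lam) / (\<tau> * lam)"
  shows "(\<forall>k\<ge>1. H (v k) \<le> exp (- \<eta> * lam * real k * \<tau>) * H (v 0)) \<and> \<eta> \<in> {0<..<1}"
proof -
  have lam_pos: "lam > 0" using lam \<open>C\<^sub>m > 0\<close> \<open>C\<^sub>M > 0\<close> \<open>\<kappa> > 0\<close> by simp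
  then have tl_pos: "\<tau> * lam > 0" using \<open>\<tau> > 0\<close> by simp
  \<comment> \<open>Working at \<open>Suc k\<close> keeps the dummy value of the production at index
    0 out of the argument and makes \<open>A1\<close> and \<open>A2\<close> applicable for every
    \<open>k\<close>.\<close>
  have prod: "\<tau> * entropy_production \<tau> H v (Suc k) = H (v k) - H (v (Suc k))" for k
    using \<open>\<tau> > 0\<close> by (simp add: entropy_production_def field_simps)
  have H_le_F: "H (v k) \<le> C\<^sub>M / \<kappa> * F (v k)" for k
  proof (rule le_if_decrement_le[OF _ _ A3])
    fix k
    have "H (v k) - H (v (Suc k)) \<le> \<tau> * (C\<^sub>M * F (v (Suc k)))"
      unfolding prod[symmetric] using A1[of "Suc k"] \<open>\<tau> > 0\<close> by (intro mult_left_mono) simp_all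
    \<comment> \<open>Splitting \<open>C\<^sub>M\<close> as
      \<open>C\<^sub>M / \<kappa> * \<kappa>\<close> isolates the quantity that \<open>A2\<close>
      bounds by the loss of \<open>F\<close>.\<close>
    also have "\<dots> = C\<^sub>M / \<kappa> * (\<tau> * \<kappa> * F (v (Suc k)))"
      using \<open>\<kappa> > 0\<close> by simp
    also have "\<dots> \<le> C\<^sub>M / \<kappa> * (F (v k) - F (v (Suc k)))"
      using A2[of "Suc k"] \<open>C\<^sub>M > 0\<close> \<open>\<kappa> > 0\<close> by (intro mult_left_mono) simp_all
    finally show "H (v k) - H (v (Suc k)) \<le> C\<^sub>M / \<kappa> * F (v k) - C\<^sub>M / \<kappa> * F (v (Suc k))"
      by (simp add: right_diff_distrib)
  qed (use F_nonneg \<open>C\<^sub>M > 0\<close> \<open>\<kappa> > 0\<close> in simp)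
  have step: "(1 + \<tau> * lam) * H (v (Suc k)) \<le> H (v k)" for k
  proof -
    \<comment> \<open>The bound is taken at the new point, as for an implicit Euler step; hence the
      factor \<open>1 + \<tau> * lam\<close> lands on the new entropy. The value of
      \<open>lam\<close> is the one for which
      \<open>lam * (C\<^sub>M / \<kappa>) = C\<^sub>m\<close>.\<close>
    have "lam * H (v (Suc k)) \<le> lam * (C\<^sub>M / \<kappa> * F (v (Suc k)))"
      using H_le_F[of "Suc k"] lam_pos by (intro mult_left_mono) simp_all
    also have "\<dots> = C\<^sub>m * F (v (Suc k))"
      using lam \<open>C\<^sub>M > 0\<close> \<open>\<kappa> > 0\<close> by simp
    also have "\<dots> \<le> entropy_production \<tau> H v (Suc k)"
      using A1[of "Suc k"] by simp
    finally have "\<tau> * (lam * H (v (Suc k))) \<le> H (v k) - H (v (Suc k))"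
      unfolding prod[symmetric] using \<open>\<tau> > 0\<close> by simp
    then show ?thesis by (simp add: algebra_simps)
  qed
  \<comment> \<open>The rate \<open>\<eta>\<close> is tuned so that
    \<open>exp (\<eta> * lam * \<tau>)\<close> is exactly the one-step factor
    \<open>1 + \<tau> * lam\<close>.\<close>
  have exp_eq: "exp (- \<eta> * lam * real k * \<tau>) = inverse ((1 + \<tau> * lam) ^ k)" for k
  proof -
    have "- \<eta> * lam * real k * \<tau> = - (real k * (\<eta> * (\<tau> * lam)))"
      by (simp add: mult_ac)
    also have "\<eta> * (\<tau> * lam) = ln (1 + \<tau> * lam)"
      using eta tl_pos by simp
    also have "exp (- (real k * ln (1 + \<tau> * lam))) = inverse ((1 + \<tau> * lam) ^ k)"
      using tl_pos by (simp only: exp_minus exp_of_nat_mult exp_ln)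
    finally show ?thesis .
  qed
  have "H (v k) \<le> exp (- \<eta> * lam * real k * \<tau>) * H (v 0)" for k
    using geometric_decay[where h = "\<lambda>k. H (v k)", OF _ step, of k] tl_pos
    unfolding exp_eq by (simp add: field_simps)
  \<comment> \<open>With \<open>x = \<tau> * lam > 0\<close>, both bounds come from
    \<open>0 < ln (1 + x) < x\<close>.\<close>
  moreover have "\<eta> \<in> {0<..<1}"
    using eta tl_pos ln_add_one_self_less_self[of "\<tau> * lam"] by simp
  ultimately show ?thesis by simp
qed

end
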